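(* The complete set of eigenpolynomials of the multivariate Krawtchouk system is, for $\boldsymbol m=(m_0,m_1,\ldots,m_{n-1})\in\mathcal X$, $$\mathcal P_{K\boldsymbol m}(\boldsymbol x;\boldsymbol a,N)=\prod_{i=1}^{n-1}\mathcal P^{(i)}_{Km_i}\Bigl(x_i,\;x_{>i}-\sum_{j=i+1}^{n-1}m_j;\;a_i,\;a_{>i}\Bigr)\;K_{m_0}\Bigl(|x|-\sum_{j=1}^{n-1}m_j;\;\frac{|a|}{|a|+1},\;N-\sum_{j=1}^{n-1}m_j\Bigr),$$ that is, explicitly, $$\mathcal P_{K\boldsymbol m}=\prod_{i=1}^{n-1}\Biggl(\sum_{k=0}^{m_i}(-1)^k\binom{m_i}{k}\Bigl(\frac{a_{>i}}{a_i}\Bigr)^k(-x_i)_k\Bigl(-x_{>i}+\sum_{j=i+1}^{n-1}m_j\Bigr)_{m_i-k}\Biggr)\times{}_2F_1\left(\begin{matrix}-m_0,\ -|x|+\sum_{j=1}^{n-1}m_j\\ -N+\sum_{j=1}^{n-1}m_j\end{matrix}\Bigm|\frac{|a|+1}{|a|}\right).$$ With $|m|=m_0+m_1+\cdots+m_{n-1}$, they satisfy $$\widetilde{\mathcal H}_{KT}\mathcal P_{K\boldsymbol m}=|m|(|a|+1)\mathcal P_{K\boldsymbol m},$$ $$\widetilde{\mathcal H}_{Ki}\mathcal P_{K\boldsymbol m}=|m|\Bigl(\sum_{j=i}^na_j\Bigr)\mathcal P_{K\boldsymbol m},\qquad i=1,\ldots,n-1,$$ $$(\mathcal P_{K\boldsymbol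 m},\mathcal P_{K\boldsymbol m'})=0,\qquad\boldsymbol m\neq\boldsymbol m',\quad \boldsymbol m,\boldsymbol m'\in\mathcal X.$$
   Context: Fix integers $N>n\ge2$ and real parameters $a_1,\ldots,a_n>0$; $\boldsymbol a=(a_1,\ldots,a_n)$, $|a|=\sum_{i=1}^na_i$. For $\boldsymbol x=(x_1,\ldots,x_n)$ let $|x|=\sum_{i=1}^nx_i$; $\mathcal X=\{\boldsymbol x\in\mathbb N_0^n: |x|\le N\}$. For $1\le i\le n-1$: $x_{>i}=x_{i+1}+\cdots+x_n$, $a_{>i}=a_{i+1}+\cdots+a_n$. $(c)_k=c(c+1)\cdots(c+k-1)$, $(c)_0=1$. Empty sums are $0$. "Complete set" means that the eigenpolynomials form a basis of the space of real polynomials in $x_1,\ldots,x_n$ of total degree $\le N$ (equivalently, of the space of real functions on $\mathcal X$). The multivariate Krawtchouk system is given by the following difference operators acting on polynomials ($\boldsymbol e_j$ the $j$-th unit vector): $\widetilde{\mathcal H}_{KT}=\widetilde{\mathcal H}_{K0}+\widetilde{\mathcal H}_{K1}$ with $$\widetilde{\mathcal H}_{K0}p(\boldsymbol x)=\sum_{j=1}^n\Bigl((N-|x|)a_j\bigl(p(\boldsymbol x)-p(\boldsymbol x+\boldsymbol e_j)\bigr)+x_j\bigl(p(\boldsymbol x)-p(\boldsymbol x-\boldsymbol e_j)\bigr)\Bigr),$$ $$\widetilde{\mathcal H}_{Ki}p(\boldsymbol x)=\sum_{\substack{i\le j,k\le n\\ j\ne k}}x_ja_k\bigl(p(\boldsymbol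 x)-p(\boldsymbol x-\boldsymbol e_j+\boldsymbol e_k)\bigr),\quad i=1,\ldots,n-1.$$ Weight and inner product: $$W_K(\boldsymbol x)=\frac{N!}{x_1!\cdots x_n!\,(N-|x|)!}\,\frac{\prod_{i=1}^na_i^{x_i}}{(1+|a|)^N},\qquad (p,q)=\sum_{\boldsymbol x\in\mathcal X}p(\boldsymbol x)q(\boldsymbol x)W_K(\boldsymbol x).$$ Single variable Krawtchouk polynomial: $K_m(x;p,N)={}_2F_1\left(\begin{matrix}-m,\ -x\\ -N\end{matrix}\Bigm|p^{-1}\right)=\sum_{k=0}^m\frac{(-m)_k(-x)_k}{(-N)_k\,k!}p^{-k}$ (the $_2F_1$ in the claim likewise denotes the sum over $0\le k\le m_0$). Type two polynomials (the superscript $(i)$ is only a label): $\mathcal P^{(i)}_{Km}(u,v;\alpha,\gamma)=\sum_{k=0}^m(-1)^k\binom mk\bigl(\gamma/\alpha\bigr)^k(-u)_k(-v)_{m-k}$.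
   Formalization: In the eigenvalue of H_{Ki} the factor |m| is replaced by m_i+...+m_{n-1}; as printed the equation fails (n=2, N=3, a=(1,1), m=(1,0), i=1: the left side is 0, the right side is 2P, nonzero), and both agree exactly when m_0=...=m_{i-1}=0. *)

theory Defs
  imports Complex_Main "HOL-Library.Function_Algebras"
begin

text \<open>
  Since \<open>n\<close> is a variable number, points of real n-space are functions on \<open>nat\<close> of which only the
  coordinates \<open>1, \<dots>, n\<close> are used, and polynomials in \<open>x\<^sub>1, \<dots>, x\<^sub>n\<close> are polynomial
  functions on such points (over the reals these carry the same information as the formal ones).
\<close>

definition fscale :: "real \<Rightarrow> ('a \<Rightarrow> real) \<Rightarrow> 'a \<Rightarrow> real" where
  "fscale c f = (\<lambda>x. c * f x)"

global_interpretation rfun: vector_space "fscale :: real \<Rightarrow> ('a \<Rightarrow> real) \<Rightarrow> 'a \<Rightarrow> real"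
  by standard (auto simp: fscale_def plus_fun_def algebra_simps)

definition is_basis_family ::
    "('i \<Rightarrow> 'a \<Rightarrow> real) \<Rightarrow> 'i set \<Rightarrow> ('a \<Rightarrow> real) set \<Rightarrow> bool" where
  "is_basis_family b I V \<longleftrightarrow>
     inj_on b I \<and> \<not> rfun.dependent (b ` I) \<and> rfun.span (b ` I) = V"

definition polys :: "nat \<Rightarrow> nat \<Rightarrow> ((nat \<Rightarrow> real) \<Rightarrow> real) set" where
  "polys n d =
     rfun.span {(\<lambda>x. \<Prod>i=1..n. x i ^ \<alpha> i) | \<alpha> :: nat \<Rightarrow> nat. (\<Sum>i=1..n. \<alpha> i) \<le> d}"

text \<open>
  The set \<open>\<X>\<close>, with its coordinates labelled by \<open>I\<close>: it is \<open>lattice_simplex {1..n} N\<close> for the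
  points \<open>x\<close> and \<open>lattice_simplex {0..<n} N\<close> for the degrees \<open>m = (m\<^sub>0, \<dots>, m\<^bsub>n-1\<^esub>)\<close>.  The value 0
  outside \<open>I\<close> makes the representing function unique.
\<close>

definition lattice_simplex :: "nat set \<Rightarrow> nat \<Rightarrow> (nat \<Rightarrow> nat) set" where
  "lattice_simplex I N = {x. (\<forall>i. i \<notin> I \<longrightarrow> x i = 0) \<and> (\<Sum>i\<in>I. x i) \<le> N}"

definition unit_vec :: "nat \<Rightarrow> nat \<Rightarrow> real" where
  "unit_vec j = (\<lambda>i. if i = j then 1 else 0)"

definition HK0 :: "nat \<Rightarrow> nat \<Rightarrow> (nat \<Rightarrow> real) \<Rightarrow>
    ((nat \<Rightarrow> real) \<Rightarrow> real) \<Rightarrow> (nat \<Rightarrow> real) \<Rightarrow> real" where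
  "HK0 n N a p = (\<lambda>x. \<Sum>j=1..n.
     (real N - (\<Sum>i=1..n. x i)) * a j * (p x - p (x + unit_vec j))
     + x j * (p x - p (x - unit_vec j)))"

text \<open>
  \<open>HK n a i\<close> acts only on \<open>x\<^sub>i, \<dots>, x\<^sub>n\<close> and preserves \<open>x\<^sub>i + \<dots> + x\<^sub>n\<close>.  In particular it annihilates
  every function of \<open>|x|\<close>, so its eigenvalues depend on \<open>m\<^sub>i, \<dots>, m\<^bsub>n-1\<^esub>\<close> only and not on all of \<open>|m|\<close>
  (take \<open>m = (1, 0, \<dots>, 0)\<close>, for which the eigenpolynomial is a nonconstant function of \<open>|x|\<close>).
\<close>

definition HK :: "nat \<Rightarrow> (nat \<Rightarrow> real) \<Rightarrow> nat \<Rightarrow>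
    ((nat \<Rightarrow> real) \<Rightarrow> real) \<Rightarrow> (nat \<Rightarrow> real) \<Rightarrow> real" where
  "HK n a i p = (\<lambda>x. \<Sum>j=i..n. \<Sum>k\<in>{i..n} - {j}.
     x j * a k * (p x - p (x - unit_vec j + unit_vec k)))"

definition HKT :: "nat \<Rightarrow> nat \<Rightarrow> (nat \<Rightarrow> real) \<Rightarrow>
    ((nat \<Rightarrow> real) \<Rightarrow> real) \<Rightarrow> (nat \<Rightarrow> real) \<Rightarrow> real" where
  "HKT n N a p = (\<lambda>x. HK0 n N a p x + HK n a 1 p x)"

definition weightK :: "nat \<Rightarrow> nat \<Rightarrow> (nat \<Rightarrow> real) \<Rightarrow> (nat \<Rightarrow> nat) \<Rightarrow> real" where
  "weightK n N a x =
     fact N / ((\<Prod>i=1..n. fact (x i)) * fact (N - (\<Sum>i=1..n. x i)))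
     * ((\<Prod>i=1..n. a i ^ x i) / (1 + (\<Sum>i=1..n. a i)) ^ N)"

definition innerK :: "nat \<Rightarrow> nat \<Rightarrow> (nat \<Rightarrow> real) \<Rightarrow>
    ((nat \<Rightarrow> real) \<Rightarrow> real) \<Rightarrow> ((nat \<Rightarrow> real) \<Rightarrow> real) \<Rightarrow> real" where
  "innerK n N a p q =
     (\<Sum>x\<in>lattice_simplex {1..n} N.
        p (\<lambda>i. real (x i)) * q (\<lambda>i. real (x i)) * weightK n N a x)"

text \<open>
  The terminating \<open>\<^sub>2F\<^sub>1(-m, b; c | z)\<close>, read as the sum over \<open>0 \<le> k \<le> m\<close>.  For \<open>c = -N'\<close> with
  \<open>m \<le> N'\<close> natural no denominator vanishes in this range.
\<close>

definition hyp2F1_term :: "nat \<Rightarrow> real \<Rightarrow> real \<Rightarrow> real \<Rightarrow> real" where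
  "hyp2F1_term m b c z =
     (\<Sum>k=0..m. pochhammer (- real m) k * pochhammer b k / (pochhammer c k * fact k) * z ^ k)"

definition krawtchouk :: "nat \<Rightarrow> real \<Rightarrow> real \<Rightarrow> real \<Rightarrow> real" where
  "krawtchouk m x p N = hyp2F1_term m (- x) (- N) (1 / p)"

definition type_two :: "nat \<Rightarrow> real \<Rightarrow> real \<Rightarrow> real \<Rightarrow> real \<Rightarrow> real" where
  "type_two m u v \<alpha> \<gamma> =
     (\<Sum>k=0..m. (-1) ^ k * real (m choose k) * (\<gamma> / \<alpha>) ^ k
        * pochhammer (- u) k * pochhammer (- v) (m - k))"

definition PK :: "nat \<Rightarrow> nat \<Rightarrow> (nat \<Rightarrow> real) \<Rightarrow> (nat \<Rightarrow> nat) \<Rightarrow> (nat \<Rightarrow> real) \<Rightarrow> real" where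
  "PK n N a m = (\<lambda>x.
     (\<Prod>i=1..n-1. type_two (m i) (x i) ((\<Sum>j=i+1..n. x j) - (\<Sum>j=i+1..n-1. real (m j)))
                      (a i) (\<Sum>j=i+1..n. a j))
     * krawtchouk (m 0) ((\<Sum>i=1..n. x i) - (\<Sum>j=1..n-1. real (m j)))
         ((\<Sum>i=1..n. a i) / ((\<Sum>i=1..n. a i) + 1)) (real N - (\<Sum>j=1..n-1. real (m j))))"

end

theory Submission
  imports Defs
begin

text \<open>
  Write \<open>T\<^sub>k\<close> for the shift \<open>x \<mapsto> x + e\<^sub>k\<close>.  On functions of \<open>x\<^sub>i, \<dots>, x\<^sub>n\<close> consider the ladder operators
  \<open>R\<^sub>i = \<Sum>\<^sub>k\<^sub>\<ge>\<^sub>i a\<^sub>k T\<^sub>k\<close> and \<open>L\<^sub>i = \<Sum>\<^sub>k\<^sub>\<ge>\<^sub>i x\<^sub>k T\<^sub>k\<^sup>-\<^sup>1\<close>.  The hopping operator factors through them: with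
  \<open>A\<^sub>i = a\<^sub>i + \<dots> + a\<^sub>n\<close> and \<open>s\<^sub>i = x\<^sub>i + \<dots> + x\<^sub>n\<close> it is \<open>A\<^sub>i s\<^sub>i - L\<^sub>i R\<^sub>i\<close> (\<open>HK_eq_ladder\<close>).  The product of
  the type two polynomials with labels \<open>i, \<dots>, n-1\<close>, of degree \<open>M\<^sub>i = m\<^sub>i + \<dots> + m\<^bsub>n-1\<^esub>\<close>, satisfies
  \<open>R\<^sub>i P = A\<^sub>i P\<close> and \<open>L\<^sub>i P = (s\<^sub>i - M\<^sub>i) P\<close> (\<open>chain_raise\<close>, \<open>chain_lower\<close>).  Both relations follow by
  downward induction on \<open>i\<close> from the two variable identities \<open>type_two_raise\<close> and \<open>type_two_lower\<close>;
  the shift by \<open>M\<^bsub>i+1\<^esub>\<close> in the second argument of a type two factor is what the \<open>L\<close>-eigenvalue of the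
  inner product calls for.  Hence \<open>P\<close> is an eigenfunction of the hopping operator with eigenvalue
  \<open>A\<^sub>i s\<^sub>i - (s\<^sub>i - M\<^sub>i) A\<^sub>i = A\<^sub>i M\<^sub>i\<close>, and multiplying it by functions that the hops leave invariant
  changes nothing.

  Applied to \<open>K(|x| - M\<^sub>1) P\<close>, the ladder relations reduce the birth and death part to a difference
  operator in the single variable \<open>|x| - M\<^sub>1\<close>, which is the Krawtchouk difference operator plus the
  constant \<open>M\<^sub>1\<close>.

  All the operators are self-adjoint for the weight by detailed balance, and their eigenvalues together
  determine all the sums \<open>m\<^sub>i + \<dots> + m\<^bsub>n-1\<^esub>\<close>, hence \<open>m\<close>; so distinct eigenpolynomials are orthogonal
  (\<open>PK_orthogonal\<close>).  None of them vanishes on the whole lattice, so they are independent, and they are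
  as many as the monomials spanning the polynomials of degree at most \<open>N\<close> (\<open>PK_basis\<close>).
\<close>

section \<open>Single variable identities\<close>

text \<open>
  In the basis \<open>(-u)\<^sub>k\<close> the forward shift lowers the index, and the backward shift multiplied by \<open>u\<close>
  is diagonal.  All later identities are comparisons of coefficients in this basis.
\<close>

lemma pochhammer_neg_raise:
  "pochhammer (- (u + 1)) k = pochhammer (- u) k - real k * pochhammer (- u) (k - 1)" for u :: real
proof (cases k)
  case (Suc l)
  have "- (u + 1) + 1 = - u" by simp
  then have *: "pochhammer (- (u + 1)) (Suc l) = - (u + 1) * pochhammer (- u) l"
    by (metis pochhammer_rec)
  show ?thesis
    unfolding Suc * by (simp add: pochhammer_Suc algebra_simps)
qed simp

lemma pochhammer_neg_lower:
  "u * pochhammer (- (u - 1)) k = (u - real k) * pochhammer (- u) k" for u :: real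
  using pochhammer_rec[of "- u" k] pochhammer_Suc[of "- u" k] by (simp add: algebra_simps)

text \<open>
  The comparison of coefficients: a part \<open>D\<close> that lowers the index meets a diagonal part \<open>E\<close> one
  index below.
\<close>

lemma sum_cancel_neighbours:
  fixes D E :: "nat \<Rightarrow> 'a :: ab_group_add"
  assumes "D 0 = 0" and "E m = 0" and "\<And>k. k < m \<Longrightarrow> D (Suc k) = - E k"
  shows "(\<Sum>k=0..m. D k + E k) = 0"
proof -
  have "(\<Sum>k=0..j. D k + E k) = E j" if "j \<le> m" for j
    using that by (induction j) (auto simp: assms)
  from this[of m] show ?thesis using assms by simp
qed

text \<open>
  Since a forward shift lowers the index, both weighted differences produce the products
  \<open>(-u)\<^sub>k (-v)\<^bsub>m-1-k\<^esub>\<close>.  The ratio \<open>\<gamma>/\<alpha>\<close> and the alternating sign in the type two polynomial are exactly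
  what makes the two contributions cancel.
\<close>

lemma type_two_raise:
  assumes "\<alpha> \<noteq> 0"
  shows "\<alpha> * type_two m (u + 1) v \<alpha> \<gamma> + \<gamma> * type_two m u (v + 1) \<alpha> \<gamma>
         = (\<alpha> + \<gamma>) * type_two m u v \<alpha> \<gamma>"
proof -
  define c where "c k = (-1) ^ k * real (m choose k) * (\<gamma> / \<alpha>) ^ k" for k
  define f where "f k = pochhammer (- u) k" for k
  define g where "g k = pochhammer (- v) k" for k
  define D where "D k = - \<alpha> * c k * (real k * f (k - 1)) * g (m - k)" for k
  define E where "E k = - \<gamma> * c k * f k * (real (m - k) * g (m - k - 1))" for k
  have "D (Suc k) = - E k" if "k < m" for k
  proof -
    have "Suc k * (m choose Suc k) = (m - k) * (m choose k)"
      by (simp only: binomial_absorption binomial_absorb_comp)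
    then have "real (Suc k) * real (m choose Suc k) = real (m - k) * real (m choose k)"
      by (metis of_nat_mult)
    moreover have "\<alpha> * c (Suc k) * real (Suc k)
        = - ((-1) ^ k * (\<gamma> / \<alpha>) ^ k * \<gamma> * (real (Suc k) * real (m choose Suc k)))"
      using assms by (simp add: c_def)
    ultimately have *: "\<alpha> * c (Suc k) * real (Suc k) = - (\<gamma> * c k * real (m - k))"
      by (simp add: c_def)
    have "D (Suc k) = - (\<alpha> * c (Suc k) * real (Suc k)) * (f k * g (m - k - 1))"
      by (simp add: D_def del: of_nat_Suc)
    also have "\<dots> = - E k" unfolding * by (simp add: E_def)
    finally show ?thesis .
  qed
  then have "(\<Sum>k=0..m. D k + E k) = 0"
    by (intro sum_cancel_neighbours) (auto simp: D_def E_def)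
  moreover have "\<alpha> * type_two m (u + 1) v \<alpha> \<gamma> + \<gamma> * type_two m u (v + 1) \<alpha> \<gamma>
      - (\<alpha> + \<gamma>) * type_two m u v \<alpha> \<gamma> = (\<Sum>k=0..m. D k + E k)"
    unfolding type_two_def pochhammer_neg_raise sum_distrib_left
      sum.distrib[symmetric] sum_subtractf[symmetric]
    by (intro sum.cong) (simp_all add: D_def E_def c_def f_def g_def algebra_simps)
  ultimately show ?thesis by simp
qed

text \<open>
  Termwise: the two backward shifts contribute \<open>u - k\<close> and \<open>v - (m - k)\<close>, whose sum is free of \<open>k\<close>.
\<close>

lemma type_two_lower:
  "u * type_two m (u - 1) v \<alpha> \<gamma> + v * type_two m u (v - 1) \<alpha> \<gamma>
   = (u + v - real m) * type_two m u v \<alpha> \<gamma>"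
proof -
  have "u * (c * pochhammer (- (u - 1)) k * pochhammer (- v) (m - k))
      + v * (c * pochhammer (- u) k * pochhammer (- (v - 1)) (m - k))
      = (u + v - real m) * (c * pochhammer (- u) k * pochhammer (- v) (m - k))"
    if "k \<le> m" for c k
  proof -
    have "u * (c * pochhammer (- (u - 1)) k * pochhammer (- v) (m - k))
      + v * (c * pochhammer (- u) k * pochhammer (- (v - 1)) (m - k))
      = c * (u * pochhammer (- (u - 1)) k) * pochhammer (- v) (m - k)
      + c * pochhammer (- u) k * (v * pochhammer (- (v - 1)) (m - k))"
      by (simp add: algebra_simps)
    also have "\<dots> = (u + v - real m) * (c * pochhammer (- u) k * pochhammer (- v) (m - k))"
      unfolding pochhammer_neg_lower using that by (simp add: of_nat_diff algebra_simps)
    finally show ?thesis .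
  qed
  then show ?thesis
    unfolding type_two_def sum_distrib_left sum.distrib[symmetric] by (intro sum.cong) auto
qed

text \<open>
  After writing \<open>N - t = (N - k + 1) + (- t + k - 1)\<close>, the birth term on \<open>(-t)\<^sub>k\<close> is a combination of
  \<open>(-t)\<^sub>k\<close> and \<open>(-t)\<^bsub>k-1\<^esub>\<close>, while the death term is \<open>k (-t)\<^sub>k\<close>.  The resulting recursion for the
  coefficients is that of the hypergeometric series.  The condition on \<open>N\<close> keeps its denominators
  nonzero up to the index \<open>m\<close>.
\<close>

lemma krawtchouk_difference_equation:
  fixes A N t :: real
  assumes "A > 0" and "\<And>k. k < m \<Longrightarrow> N \<noteq> real k"
  defines "K \<equiv> \<lambda>t. krawtchouk m t (A / (A + 1)) N"
  shows "(N - t) * A * (K t - K (t + 1)) + t * (K t - K (t - 1)) = real m * (A + 1) * K t"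
proof -
  define c where "c k = pochhammer (- real m) k / (pochhammer (- N) k * fact k) * ((A + 1) / A) ^ k"
    for k
  define f where "f k = pochhammer (- t) k" for k
  define D where "D k = A * c k * real k * (N - real k + 1) * f (k - 1)" for k
  define E where "E k = c k * (real k - real m) * (A + 1) * f k" for k
  have K: "K t = (\<Sum>k=0..m. c k * pochhammer (- t) k)" for t
    unfolding K_def krawtchouk_def hyp2F1_term_def c_def
    by (intro sum.cong) (auto simp: field_simps)
  have "D (Suc k) = - E k" if "k < m" for k
  proof -
    have "c (Suc k) * (real (Suc k) * (N - real k) * A) = c k * ((real m - real k) * (A + 1))"
      using assms(1) assms(2)[OF that]
      by (simp add: c_def pochhammer_Suc divide_simps del: of_nat_Suc)
        (simp add: algebra_simps)
    moreover have "D (Suc k) = c (Suc k) * (real (Suc k) * (N - real k) * A) * f k"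
      by (simp add: D_def)
    ultimately have "D (Suc k) = c k * ((real m - real k) * (A + 1)) * f k" by simp
    then show ?thesis by (simp add: E_def algebra_simps)
  qed
  then have "(\<Sum>k=0..m. D k + E k) = 0"
    by (intro sum_cancel_neighbours) (auto simp: D_def E_def)
  moreover have "(N - t) * A * (K t - K (t + 1)) + t * (K t - K (t - 1)) - real m * (A + 1) * K t
      = (\<Sum>k=0..m. D k + E k)"
  proof -
    have "(N - t) * A * (c k * f k - c k * pochhammer (- (t + 1)) k)
        + t * (c k * f k - c k * pochhammer (- (t - 1)) k) - real m * (A + 1) * (c k * f k)
        = D k + E k" for k
    proof -
      have *: "t * (c k * f k - c k * pochhammer (- (t - 1)) k) = c k * real k * f k"
        using arg_cong[OF pochhammer_neg_lower[of t k], of "(*) (c k)"]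
        by (simp add: f_def algebra_simps)
      have "A * c k * (real k * f k) = A * c k * (real k * ((- t + real k - 1) * f (k - 1)))"
        by (cases k) (auto simp: f_def pochhammer_Suc)
      then have "(N - t) * A * (c k * (real k * f (k - 1)))
          = A * c k * real k * (N - real k + 1) * f (k - 1) + A * c k * (real k * f k)"
        by (simp add: algebra_simps)
      then show ?thesis
        unfolding * pochhammer_neg_raise D_def E_def by (simp add: f_def algebra_simps)
    qed
    then show ?thesis
      unfolding K sum_distrib_left sum.distrib[symmetric] sum_subtractf[symmetric]
      by (intro sum.cong) (simp_all add: f_def)
  qed
  ultimately show ?thesis by simp
qed

section \<open>Ladder relations for the chain of type two polynomials\<close>

lemma sum_unit_vec:
  "finite A \<Longrightarrow> (\<Sum>j\<in>A. unit_vec k j) = (if k \<in> A then 1 else 0)"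
  by (simp add: unit_vec_def)

definition chain_factor ::
    "nat \<Rightarrow> (nat \<Rightarrow> real) \<Rightarrow> (nat \<Rightarrow> nat) \<Rightarrow> nat \<Rightarrow> (nat \<Rightarrow> real) \<Rightarrow> real" where
  "chain_factor n a m l x =
     type_two (m l) (x l) ((\<Sum>j=l+1..n. x j) - (\<Sum>j=l+1..n-1. real (m j)))
       (a l) (\<Sum>j=l+1..n. a j)"

definition chain ::
    "nat \<Rightarrow> (nat \<Rightarrow> real) \<Rightarrow> (nat \<Rightarrow> nat) \<Rightarrow> nat \<Rightarrow> (nat \<Rightarrow> real) \<Rightarrow> real" where
  "chain n a m i x = (\<Prod>l=i..n-1. chain_factor n a m l x)"

lemma PK_eq_chain:
  "PK n N a m x = chain n a m 1 x
     * krawtchouk (m 0) ((\<Sum>i=1..n. x i) - (\<Sum>j=1..n-1. real (m j)))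
         ((\<Sum>i=1..n. a i) / ((\<Sum>i=1..n. a i) + 1)) (real N - (\<Sum>j=1..n-1. real (m j)))"
  by (simp add: PK_def chain_def chain_factor_def)

lemma chain_cong:
  assumes "\<And>j. j \<in> {i..n} \<Longrightarrow> x j = y j"
  shows "chain n a m i x = chain n a m i y"
  unfolding chain_def
proof (rule prod.cong[OF refl])
  fix l assume "l \<in> {i..n-1}"
  then have "x l = y l" "(\<Sum>j=l+1..n. x j) = (\<Sum>j=l+1..n. y j)"
    by (auto intro!: assms sum.cong)
  then show "chain_factor n a m l x = chain_factor n a m l y" by (simp add: chain_factor_def)
qed

lemma chain_step:
  "i < n \<Longrightarrow> chain n a m i x = chain_factor n a m i x * chain n a m (Suc i) x"
  unfolding chain_def by (subst prod.atLeast_Suc_atMost) auto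

text \<open>
  For an index \<open>k\<close> beyond \<open>i\<close>, the leading factor sees the shift by \<open>e\<^sub>k\<close> only through its second
  argument, whichever \<open>k\<close> it is.  So the remaining chain is hit by its own operator \<open>R\<close>, and the
  two variable identity with \<open>\<gamma> = a\<^bsub>i+1\<^esub> + \<dots> + a\<^sub>n\<close> finishes the step.
\<close>

lemma chain_raise:
  assumes "1 \<le> i" "i \<le> n" and pos: "\<And>j. j \<in> {1..n} \<Longrightarrow> 0 < a j"
  shows "(\<Sum>k=i..n. a k * chain n a m i (x + unit_vec k)) = (\<Sum>k=i..n. a k) * chain n a m i x"
  using assms(2)
proof (induction rule: inc_induct)
  case base
  show ?case using assms by (simp add: chain_def)
next
  case (step i')
  define A where "A = (\<Sum>k=Suc i'..n. a k)"
  define v where "v = (\<Sum>j=Suc i'..n. x j) - (\<Sum>j=Suc i'..n-1. real (m j))"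
  define T where "T u v = type_two (m i') u v (a i') A" for u v
  have self: "chain n a m i' (x + unit_vec i') = T (x i' + 1) v * chain n a m (Suc i') x"
  proof -
    have "chain n a m (Suc i') (x + unit_vec i') = chain n a m (Suc i') x"
      by (rule chain_cong) (auto simp: unit_vec_def)
    then show ?thesis
      using step.hyps
      by (simp add: chain_step chain_factor_def T_def v_def A_def sum.distrib unit_vec_def)
  qed
  have later: "chain n a m i' (x + unit_vec k) = T (x i') (v + 1) * chain n a m (Suc i') (x + unit_vec k)"
    if "k \<in> {Suc i'..n}" for k
    using step.hyps that
    by (simp add: chain_step chain_factor_def T_def v_def A_def sum.distrib unit_vec_def algebra_simps)
  have "(\<Sum>k=i'..n. a k * chain n a m i' (x + unit_vec k))
      = a i' * chain n a m i' (x + unit_vec i')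
        + (\<Sum>k=Suc i'..n. a k * chain n a m i' (x + unit_vec k))"
    using step.hyps by (subst sum.atLeast_Suc_atMost) auto
  also have "(\<Sum>k=Suc i'..n. a k * chain n a m i' (x + unit_vec k))
      = T (x i') (v + 1) * (\<Sum>k=Suc i'..n. a k * chain n a m (Suc i') (x + unit_vec k))"
    unfolding sum_distrib_left by (intro sum.cong) (auto simp: later)
  also have "\<dots> = T (x i') (v + 1) * (A * chain n a m (Suc i') x)"
    unfolding step.IH A_def ..
  also have "a i' * chain n a m i' (x + unit_vec i') + \<dots>
      = (a i' * T (x i' + 1) v + A * T (x i') (v + 1)) * chain n a m (Suc i') x"
    by (simp add: self algebra_simps)
  also have "a i' * T (x i' + 1) v + A * T (x i') (v + 1) = (a i' + A) * T (x i') v"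
    unfolding T_def using pos[of i'] step.hyps assms(1) by (intro type_two_raise) auto
  also have "(a i' + A) * T (x i') v * chain n a m (Suc i') x
      = (\<Sum>k=i'..n. a k) * chain n a m i' x"
    using step.hyps
    by (simp add: chain_step chain_factor_def T_def v_def A_def sum.atLeast_Suc_atMost)
  finally show ?case .
qed

text \<open>
  As for raising.  The eigenvalue of the remaining chain is precisely the shifted second argument \<open>v\<close>
  of the leading factor, which is the coefficient that the two variable identity needs.
\<close>

lemma chain_lower:
  assumes "1 \<le> i" "i \<le> n"
  shows "(\<Sum>k=i..n. x k * chain n a m i (x - unit_vec k))
         = ((\<Sum>k=i..n. x k) - (\<Sum>j=i..n-1. real (m j))) * chain n a m i x"
  using assms(2)
proof (induction rule: inc_induct)
  case base
  show ?case using assms by (simp add: chain_def)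
next
  case (step i')
  define A where "A = (\<Sum>k=Suc i'..n. a k)"
  define v where "v = (\<Sum>j=Suc i'..n. x j) - (\<Sum>j=Suc i'..n-1. real (m j))"
  define T where "T u v = type_two (m i') u v (a i') A" for u v
  have self: "chain n a m i' (x - unit_vec i') = T (x i' - 1) v * chain n a m (Suc i') x"
  proof -
    have "chain n a m (Suc i') (x - unit_vec i') = chain n a m (Suc i') x"
      by (rule chain_cong) (auto simp: unit_vec_def)
    then show ?thesis
      using step.hyps
      by (simp add: chain_step chain_factor_def T_def v_def A_def sum_subtractf unit_vec_def)
  qed
  have later: "chain n a m i' (x - unit_vec k) = T (x i') (v - 1) * chain n a m (Suc i') (x - unit_vec k)"
    if "k \<in> {Suc i'..n}" for k
    using step.hyps that
    by (simp add: chain_step chain_factor_def T_def v_def A_def sum_subtractf unit_vec_def algebra_simps)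
  have "(\<Sum>k=i'..n. x k * chain n a m i' (x - unit_vec k))
      = x i' * chain n a m i' (x - unit_vec i')
        + (\<Sum>k=Suc i'..n. x k * chain n a m i' (x - unit_vec k))"
    using step.hyps by (subst sum.atLeast_Suc_atMost) auto
  also have "(\<Sum>k=Suc i'..n. x k * chain n a m i' (x - unit_vec k))
      = T (x i') (v - 1) * (\<Sum>k=Suc i'..n. x k * chain n a m (Suc i') (x - unit_vec k))"
    unfolding sum_distrib_left by (intro sum.cong) (auto simp: later)
  also have "\<dots> = T (x i') (v - 1) * (v * chain n a m (Suc i') x)"
    unfolding step.IH v_def ..
  also have "x i' * chain n a m i' (x - unit_vec i') + \<dots>
      = (x i' * T (x i' - 1) v + v * T (x i') (v - 1)) * chain n a m (Suc i') x"
    by (simp add: self algebra_simps)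
  also have "x i' * T (x i' - 1) v + v * T (x i') (v - 1) = (x i' + v - real (m i')) * T (x i') v"
    unfolding T_def by (rule type_two_lower)
  also have "(x i' + v - real (m i')) * T (x i') v * chain n a m (Suc i') x
      = ((\<Sum>k=i'..n. x k) - (\<Sum>j=i'..n-1. real (m j))) * chain n a m i' x"
    using step.hyps
    by (simp add: chain_step chain_factor_def T_def v_def A_def sum.atLeast_Suc_atMost)
  finally show ?case .
qed

section \<open>The eigenvalue equations\<close>

text \<open>
  With the diagonal terms, which vanish, the sum factors into the ladder operators and its two indices
  can be interchanged.
\<close>

lemma HK_eq_full_sum:
  "HK n a i p x = (\<Sum>j=i..n. \<Sum>k=i..n. x j * a k * (p x - p (x - unit_vec j + unit_vec k)))"
  unfolding HK_def
proof (rule sum.cong[OF refl])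
  fix j assume "j \<in> {i..n}"
  then show "(\<Sum>k\<in>{i..n} - {j}. x j * a k * (p x - p (x - unit_vec j + unit_vec k)))
      = (\<Sum>k=i..n. x j * a k * (p x - p (x - unit_vec j + unit_vec k)))"
    by (subst (2) sum.remove[of _ j]) auto
qed

lemma HK_eq_ladder:
  "HK n a i p x = (\<Sum>j=i..n. x j) * (\<Sum>k=i..n. a k) * p x
     - (\<Sum>j=i..n. x j * (\<Sum>k=i..n. a k * p (x - unit_vec j + unit_vec k)))"
proof -
  have "(\<Sum>j=i..n. x j) * (\<Sum>k=i..n. a k) * p x = (\<Sum>j=i..n. \<Sum>k=i..n. x j * a k * p x)"
    unfolding sum_product by (simp only: sum_distrib_right)
  then show ?thesis
    by (simp add: HK_eq_full_sum right_diff_distrib sum_subtractf sum_distrib_left mult.assoc)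
qed

lemma HK_times_invariant:
  assumes "\<And>j k. j \<in> {i..n} \<Longrightarrow> k \<in> {i..n} \<Longrightarrow> q (x - unit_vec j + unit_vec k) = q x"
  shows "HK n a i (\<lambda>x. q x * p x) x = q x * HK n a i p x"
  unfolding HK_eq_full_sum sum_distrib_left
  by (intro sum.cong) (simp_all add: assms right_diff_distrib mult.left_commute)

text \<open>
  In the factorisation through the ladder operators the terms \<open>A\<^sub>i s\<^sub>i\<close> cancel.
\<close>

lemma HK_chain:
  assumes "1 \<le> i" "i \<le> n" and "\<And>j. j \<in> {1..n} \<Longrightarrow> 0 < a j"
  shows "HK n a i (chain n a m i) x
    = real (\<Sum>j=i..n-1. m j) * (\<Sum>k=i..n. a k) * chain n a m i x"
proof -
  have "(\<Sum>j=i..n. x j * (\<Sum>k=i..n. a k * chain n a m i (x - unit_vec j + unit_vec k)))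
      = (\<Sum>k=i..n. a k) * (\<Sum>j=i..n. x j * chain n a m i (x - unit_vec j))"
  proof -
    have "(\<Sum>k=i..n. a k * chain n a m i (x - unit_vec j + unit_vec k))
        = (\<Sum>k=i..n. a k) * chain n a m i (x - unit_vec j)" for j
      using assms by (rule chain_raise)
    then show ?thesis by (simp only: sum_distrib_left mult.left_commute)
  qed
  also have "\<dots> = (\<Sum>k=i..n. a k)
      * (((\<Sum>k=i..n. x k) - (\<Sum>j=i..n-1. real (m j))) * chain n a m i x)"
    using assms by (simp add: chain_lower)
  finally show ?thesis by (simp add: HK_eq_ladder algebra_simps)
qed

lemma chain_split:
  assumes "1 \<le> i" "i \<le> n"
  shows "chain n a m 1 x = (\<Prod>l=1..<i. chain_factor n a m l x) * chain n a m i x"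
proof -
  have "{1..n-1} = {1..<i} \<union> {i..n-1}" using assms by auto
  then show ?thesis unfolding chain_def by (simp add: prod.union_disjoint ivl_disj_int)
qed

text \<open>
  The factors with labels below \<open>i\<close> and the Krawtchouk factor depend only on \<open>x\<^sub>1, \<dots>, x\<^bsub>i-1\<^esub>\<close> and on tail
  sums that contain all of \<open>x\<^sub>i, \<dots>, x\<^sub>n\<close>; a hop within \<open>i, \<dots>, n\<close> preserves them.
\<close>

lemma HK_PK:
  assumes "1 \<le> i" "i \<le> n" and "\<And>j. j \<in> {1..n} \<Longrightarrow> 0 < a j"
  shows "HK n a i (PK n N a m) x
    = real (\<Sum>j=i..n-1. m j) * (\<Sum>k=i..n. a k) * PK n N a m x"
proof -
  define q where "q = (\<lambda>x. (\<Prod>l=1..<i. chain_factor n a m l x)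
     * krawtchouk (m 0) ((\<Sum>i=1..n. x i) - (\<Sum>j=1..n-1. real (m j)))
         ((\<Sum>i=1..n. a i) / ((\<Sum>i=1..n. a i) + 1)) (real N - (\<Sum>j=1..n-1. real (m j))))"
  have PK: "PK n N a m = (\<lambda>x. q x * chain n a m i x)"
    by (rule ext) (simp only: PK_eq_chain chain_split[OF assms(1,2)] q_def mult_ac)
  have "q (x - unit_vec j + unit_vec k) = q x" if "j \<in> {i..n}" "k \<in> {i..n}" for j k
  proof -
    have tail: "(\<Sum>l=l'..n. (x - unit_vec j + unit_vec k) l) = (\<Sum>l=l'..n. x l)"
      if "l' \<le> i" for l'
      using that \<open>j \<in> {i..n}\<close> \<open>k \<in> {i..n}\<close>
      by (simp add: sum.distrib sum_subtractf sum_unit_vec)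
    have "chain_factor n a m l (x - unit_vec j + unit_vec k) = chain_factor n a m l x"
      if "l \<in> {1..<i}" for l
      using that tail[of "l + 1"] \<open>j \<in> {i..n}\<close> \<open>k \<in> {i..n}\<close>
      by (simp add: chain_factor_def unit_vec_def)
    with tail[of 1] assms(1) show ?thesis by (simp add: q_def)
  qed
  then have "HK n a i (PK n N a m) x = q x * HK n a i (chain n a m i) x"
    unfolding PK by (rule HK_times_invariant)
  then show ?thesis by (simp only: HK_chain[of i n a, OF assms] PK mult_ac)
qed

lemma HK0_eq_ladder:
  "HK0 n N a p x =
     (real N - (\<Sum>i=1..n. x i)) * ((\<Sum>j=1..n. a j) * p x - (\<Sum>j=1..n. a j * p (x + unit_vec j)))
     + ((\<Sum>j=1..n. x j) * p x - (\<Sum>j=1..n. x j * p (x - unit_vec j)))"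
  unfolding HK0_def sum.distrib
  by (simp add: sum_distrib_left sum_distrib_right sum_subtractf right_diff_distrib mult.assoc)

text \<open>
  The death part of \<open>HK0\<close> meets the \<open>L\<close>-eigenvalue \<open>s - M\<close> of the chain instead of \<open>s\<close>.  Splitting off
  the constant \<open>M\<close> leaves the Krawtchouk operator in the variable \<open>s - M\<close> for \<open>N - M\<close>, and \<open>M\<close> together
  with the hopping eigenvalue \<open>M |a|\<close> supplies \<open>M (|a| + 1)\<close>.
\<close>

lemma HKT_PK:
  assumes "1 \<le> n" and pos: "\<And>j. j \<in> {1..n} \<Longrightarrow> 0 < a j"
    and deg: "(\<Sum>j=0..n-1. m j) \<le> N"
  shows "HKT n N a (PK n N a m) x
    = real (\<Sum>j=0..n-1. m j) * ((\<Sum>i=1..n. a i) + 1) * PK n N a m x"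
proof -
  define A where "A = (\<Sum>i=1..n. a i)"
  define s where "s = (\<Sum>i=1..n. x i)"
  define M where "M = (\<Sum>j=1..n-1. real (m j))"
  define C where "C = chain n a m 1 x"
  define K where "K = (\<lambda>t. krawtchouk (m 0) t (A / (A + 1)) (real N - M))"
  have total: "real (\<Sum>j=0..n-1. m j) = real (m 0) + M"
    by (simp add: M_def sum.atLeast_Suc_atMost)
  have "A > 0" unfolding A_def using assms by (intro sum_pos) auto
  have PK: "PK n N a m = (\<lambda>y. K ((\<Sum>i=1..n. y i) - M) * chain n a m 1 y)"
    by (simp add: fun_eq_iff PK_eq_chain K_def A_def M_def)
  have up: "(\<Sum>j=1..n. a j * PK n N a m (x + unit_vec j)) = K (s - M + 1) * (A * C)"
  proof -
    have "PK n N a m (x + unit_vec j) = K (s - M + 1) * chain n a m 1 (x + unit_vec j)"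
      if "j \<in> {1..n}" for j
      using that by (simp add: PK s_def sum.distrib sum_unit_vec algebra_simps)
    then have "(\<Sum>j=1..n. a j * PK n N a m (x + unit_vec j))
        = K (s - M + 1) * (\<Sum>j=1..n. a j * chain n a m 1 (x + unit_vec j))"
      unfolding sum_distrib_left by (intro sum.cong) auto
    then show ?thesis
      using chain_raise[of 1 n a, OF order_refl assms(1) pos, of m x] by (simp add: A_def C_def)
  qed
  have down: "(\<Sum>j=1..n. x j * PK n N a m (x - unit_vec j)) = K (s - M - 1) * ((s - M) * C)"
  proof -
    have "PK n N a m (x - unit_vec j) = K (s - M - 1) * chain n a m 1 (x - unit_vec j)"
      if "j \<in> {1..n}" for j
      using that by (simp add: PK s_def sum_subtractf sum_unit_vec algebra_simps)
    then have "(\<Sum>j=1..n. x j * PK n N a m (x - unit_vec j))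
        = K (s - M - 1) * (\<Sum>j=1..n. x j * chain n a m 1 (x - unit_vec j))"
      unfolding sum_distrib_left by (intro sum.cong) auto
    then show ?thesis using assms(1) by (simp add: chain_lower s_def M_def C_def)
  qed
  have "real N - M \<noteq> real k" if "k < m 0" for k
    using that deg total by linarith
  then have "((real N - M) - (s - M)) * A * (K (s - M) - K (s - M + 1))
      + (s - M) * (K (s - M) - K (s - M - 1)) = real (m 0) * (A + 1) * K (s - M)"
    unfolding K_def using \<open>A > 0\<close> by (intro krawtchouk_difference_equation) auto
  then have kr: "(real N - s) * A * (K (s - M) - K (s - M + 1))
      + (s - M) * (K (s - M) - K (s - M - 1)) = real (m 0) * (A + 1) * K (s - M)"
    by simp
  have "HK0 n N a (PK n N a m) x
      = ((real N - s) * A * (K (s - M) - K (s - M + 1))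
         + (s - M) * (K (s - M) - K (s - M - 1)) + M * K (s - M)) * C"
    unfolding HK0_eq_ladder up down
    unfolding PK s_def[symmetric] A_def[symmetric] C_def[symmetric] by (simp add: algebra_simps)
  moreover have "HK n a 1 (PK n N a m) x = M * A * (K (s - M) * C)"
    using assms HK_PK[of 1 n a N m x] by (simp add: PK M_def A_def s_def C_def)
  ultimately have "HKT n N a (PK n N a m) x = (real (m 0) + M) * (A + 1) * (K (s - M) * C)"
    unfolding HKT_def kr by (simp add: algebra_simps)
  then show ?thesis unfolding total by (simp add: PK A_def s_def C_def)
qed

section \<open>Self-adjointness and orthogonality\<close>

abbreviation (input) real_point :: "(nat \<Rightarrow> nat) \<Rightarrow> nat \<Rightarrow> real" where
  "real_point x \<equiv> (\<lambda>i. real (x i))"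

lemma finite_lattice_simplex:
  assumes "finite I"
  shows "finite (lattice_simplex I N)"
proof (rule finite_subset)
  show "lattice_simplex I N \<subseteq> {x. \<forall>i. (i \<in> I \<longrightarrow> x i \<in> {..N}) \<and> (i \<notin> I \<longrightarrow> x i = 0)}"
  proof
    fix x assume x: "x \<in> lattice_simplex I N"
    have "x i \<le> N" if "i \<in> I" for i
    proof -
      have "x i \<le> (\<Sum>i\<in>I. x i)" using assms that by (intro member_le_sum) auto
      then show ?thesis using x by (simp add: lattice_simplex_def)
    qed
    then show "x \<in> {x. \<forall>i. (i \<in> I \<longrightarrow> x i \<in> {..N}) \<and> (i \<notin> I \<longrightarrow> x i = 0)}"
      using x by (simp add: lattice_simplex_def)
  qed
  show "finite {x. \<forall>i. (i \<in> I \<longrightarrow> x i \<in> {..N}) \<and> (i \<notin> I \<longrightarrow> x i = (0 :: nat))}"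
    using assms by (intro finite_set_of_finite_funs) auto
qed

lemma weightK_pos:
  assumes "\<And>j. j \<in> {1..n} \<Longrightarrow> 0 < a j"
  shows "weightK n N a x > 0"
proof -
  have "(\<Sum>i=1..n. a i) \<ge> 0" using assms by (intro sum_nonneg) (auto simp: less_imp_le)
  then show ?thesis
    unfolding weightK_def using assms
    by (intro mult_pos_pos divide_pos_pos prod_pos zero_less_power) auto
qed

lemma weightK_raise:
  assumes j: "j \<in> {1..n}" and less: "(\<Sum>i=1..n. z i) < N"
  shows "real (Suc (z j)) * weightK n N a (z(j := Suc (z j)))
       = (real N - real (\<Sum>i=1..n. z i)) * a j * weightK n N a z"
proof -
  let ?y = "z(j := Suc (z j))"
  let ?R = "{1..n} - {j}"
  have sum: "(\<Sum>i=1..n. ?y i) = Suc (\<Sum>i=1..n. z i)"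
  proof -
    have "(\<Sum>i\<in>?R. ?y i) = (\<Sum>i\<in>?R. z i)" by (intro sum.cong) auto
    then show ?thesis unfolding sum.remove[OF finite_atLeastAtMost j] by simp
  qed
  have fct: "(\<Prod>i=1..n. fact (?y i)) = real (Suc (z j)) * (\<Prod>i=1..n. fact (z i) :: real)"
  proof -
    have "(\<Prod>i\<in>?R. fact (?y i)) = (\<Prod>i\<in>?R. fact (z i) :: real)" by (intro prod.cong) auto
    then show ?thesis unfolding prod.remove[OF finite_atLeastAtMost j] by simp
  qed
  have pw: "(\<Prod>i=1..n. a i ^ ?y i) = a j * (\<Prod>i=1..n. a i ^ z i)"
  proof -
    have "(\<Prod>i\<in>?R. a i ^ ?y i) = (\<Prod>i\<in>?R. a i ^ z i)" by (intro prod.cong) auto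
    then show ?thesis unfolding prod.remove[OF finite_atLeastAtMost j] by simp
  qed
  obtain d where d: "N = Suc ((\<Sum>i=1..n. z i) + d)" using less less_imp_Suc_add by blast
  then have "N - (\<Sum>i=1..n. z i) = Suc d" "N - (\<Sum>i=1..n. ?y i) = d"
    and "real N - real (\<Sum>i=1..n. z i) = real (Suc d)"
    unfolding sum by auto
  moreover have "(\<Prod>i=1..n. fact (z i) :: real) \<noteq> 0" by simp
  ultimately show ?thesis
    unfolding weightK_def fct pw by (simp add: field_simps del: of_nat_Suc)
qed

text \<open>
  Detailed balance in summed form, by the substitution \<open>x = z + e\<^sub>j\<close>.  The points that it misses are
  those with \<open>x\<^sub>j = 0\<close> and those with \<open>|z| = N\<close>, where the respective factor vanishes.
\<close>

lemma sum_weight_raise: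
  assumes j: "j \<in> {1..n}"
  shows "(\<Sum>x\<in>lattice_simplex {1..n} N. real (x j) * F (real_point x) * weightK n N a x)
    = (\<Sum>z\<in>lattice_simplex {1..n} N. (real N - real (\<Sum>i=1..n. z i)) * a j
         * F (real_point z + unit_vec j) * weightK n N a z)"
proof -
  let ?X = "lattice_simplex {1..n} N"
  let ?g = "\<lambda>x. real (x j) * F (real_point x) * weightK n N a x"
  let ?h = "\<lambda>z. (real N - real (\<Sum>i=1..n. z i)) * a j * F (real_point z + unit_vec j) * weightK n N a z"
  let ?X1 = "{x \<in> ?X. 0 < x j}"
  let ?X2 = "{z \<in> ?X. (\<Sum>i=1..n. z i) < N}"
  have fin: "finite ?X" by (simp add: finite_lattice_simplex)
  have sum_upd: "(\<Sum>i=1..n. (z(j := c)) i) + z j = (\<Sum>i=1..n. z i) + c" for z :: "nat \<Rightarrow> nat" and c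
  proof -
    have "(\<Sum>i\<in>{1..n} - {j}. (z(j := c)) i) = (\<Sum>i\<in>{1..n} - {j}. z i)" by (intro sum.cong) auto
    then show ?thesis unfolding sum.remove[OF finite_atLeastAtMost j] by simp
  qed
  have "sum ?g ?X = sum ?g ?X1"
    using fin by (intro sum.mono_neutral_right) auto
  also have "\<dots> = sum ?h ?X2"
  proof (rule sum.reindex_bij_witness[where j = "\<lambda>x. x(j := x j - 1)" and i = "\<lambda>z. z(j := Suc (z j))"])
    fix x assume "x \<in> ?X1"
    then have x: "x \<in> ?X" "x j > 0" by auto
    let ?z = "x(j := x j - 1)"
    show undo: "?z(j := Suc (?z j)) = x" using x by auto
    have less: "(\<Sum>i=1..n. ?z i) < N"
      using sum_upd[of x "x j - 1"] x by (auto simp: lattice_simplex_def)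
    then show "?z \<in> ?X2"
      using x j by (auto simp: lattice_simplex_def)
    have point: "real_point ?z + unit_vec j = real_point x"
      using x by (auto simp: fun_eq_iff unit_vec_def)
    have weight: "(real N - real (\<Sum>i=1..n. ?z i)) * a j * weightK n N a ?z
        = real (x j) * weightK n N a x"
      using weightK_raise[OF j less, of a] x(2) unfolding undo
      by (simp del: of_nat_sum fun_upd_apply add: fun_upd_same)
    have "(real N - real (\<Sum>i=1..n. ?z i)) * a j * F (real_point x) * weightK n N a ?z
        = (real N - real (\<Sum>i=1..n. ?z i)) * a j * weightK n N a ?z * F (real_point x)"
      by (simp only: mult_ac)
    also have "\<dots> = ?g x"
      unfolding weight by (simp only: mult_ac)
    finally show "?h ?z = ?g x"
      unfolding point .
  next
    fix z assume "z \<in> ?X2"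
    then have z: "z \<in> ?X" "(\<Sum>i=1..n. z i) < N" by auto
    show "(z(j := Suc (z j)))(j := (z(j := Suc (z j))) j - 1) = z" by simp
    show "z(j := Suc (z j)) \<in> ?X1"
      using z j sum_upd[of z "Suc (z j)"] by (auto simp: lattice_simplex_def)
  qed
  also have "\<dots> = sum ?h ?X"
  proof (intro sum.mono_neutral_left fin ballI)
    fix z assume "z \<in> ?X - ?X2"
    then have "(\<Sum>i=1..n. z i) = N" unfolding lattice_simplex_def by auto
    then show "?h z = 0" by (simp only: diff_self mult_zero_left)
  qed auto
  finally show ?thesis .
qed

text \<open>
  A hop from \<open>j\<close> to \<open>k\<close> is a death at \<open>j\<close> followed by a birth at \<open>k\<close>.  Taking the intermediate point \<open>z\<close> as
  summation variable turns both sides into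
  \<open>\<Sum>\<^sub>z (N - |z|) a\<^sub>j a\<^sub>k p(z + e\<^sub>k) q(z + e\<^sub>j) W(z)\<close>.
\<close>

lemma sum_weight_hop:
  assumes "j \<in> {1..n}" "k \<in> {1..n}"
  shows "(\<Sum>x\<in>lattice_simplex {1..n} N. real (x j) * a k
           * p (real_point x - unit_vec j + unit_vec k) * q (real_point x) * weightK n N a x)
    = (\<Sum>x\<in>lattice_simplex {1..n} N. real (x k) * a j
           * p (real_point x) * q (real_point x - unit_vec k + unit_vec j) * weightK n N a x)"
proof -
  have "(\<Sum>x\<in>lattice_simplex {1..n} N. real (x j) * a k
           * p (real_point x - unit_vec j + unit_vec k) * q (real_point x) * weightK n N a x)
      = (\<Sum>x\<in>lattice_simplex {1..n} N. (real N - real (\<Sum>i=1..n. x i)) * (a j * a k)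
           * p (real_point x + unit_vec k) * q (real_point x + unit_vec j) * weightK n N a x)"
    if "j \<in> {1..n}" for p q :: "(nat \<Rightarrow> real) \<Rightarrow> real" and j k
    using sum_weight_raise[OF that, where N = N and a = a
        and F = "\<lambda>y. a k * p (y - unit_vec j + unit_vec k) * q y"]
    by (simp only: add_diff_cancel_right' mult_ac)
  from this[of j k p q] this[of k j q p] show ?thesis
    using assms by (simp only: mult_ac)
qed

lemma innerK_commute: "innerK n N a p q = innerK n N a q p"
  by (simp add: innerK_def mult.commute mult.left_commute)

lemma innerK_scale_left: "innerK n N a (\<lambda>x. c * p x) q = c * innerK n N a p q"
  by (simp add: innerK_def sum_distrib_left mult.assoc)

lemma innerK_add_left:
  "innerK n N a (\<lambda>x. p x + p' x) q = innerK n N a p q + innerK n N a p' q"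
  by (simp add: innerK_def sum.distrib distrib_right)

lemma innerK_sum_left:
  "innerK n N a (\<lambda>x. \<Sum>s\<in>S. p s x) q = (\<Sum>s\<in>S. innerK n N a (p s) q)"
  unfolding innerK_def sum_distrib_right by (rule sum.swap)

lemma HK_self_adjoint:
  assumes "1 \<le> i"
  shows "innerK n N a (HK n a i p) q = innerK n N a p (HK n a i q)"
proof -
  let ?X = "lattice_simplex {1..n} N"
  have expand: "innerK n N a (HK n a i p) q
      = (\<Sum>j=i..n. \<Sum>k=i..n. \<Sum>x\<in>?X. real (x j) * a k * p (real_point x) * q (real_point x)
           * weightK n N a x)
      - (\<Sum>j=i..n. \<Sum>k=i..n. \<Sum>x\<in>?X. real (x j) * a k
           * p (real_point x - unit_vec j + unit_vec k) * q (real_point x) * weightK n N a x)" for p q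
    unfolding HK_eq_full_sum[abs_def] innerK_sum_left sum_subtractf[symmetric] innerK_def
    by (intro sum.cong refl) (simp add: algebra_simps)
  have "(\<Sum>j=i..n. \<Sum>k=i..n. \<Sum>x\<in>?X. real (x j) * a k
           * p (real_point x - unit_vec j + unit_vec k) * q (real_point x) * weightK n N a x)
      = (\<Sum>j=i..n. \<Sum>k=i..n. \<Sum>x\<in>?X. real (x k) * a j
           * p (real_point x) * q (real_point x - unit_vec k + unit_vec j) * weightK n N a x)"
    using assms by (intro sum.cong refl sum_weight_hop) auto
  also have "\<dots> = (\<Sum>k=i..n. \<Sum>j=i..n. \<Sum>x\<in>?X. real (x k) * a j
           * p (real_point x) * q (real_point x - unit_vec k + unit_vec j) * weightK n N a x)"
    by (rule sum.swap)
  finally show ?thesis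
    unfolding innerK_commute[of n N a p] expand by (simp add: mult_ac)
qed

lemma HK0_self_adjoint: "innerK n N a (HK0 n N a p) q = innerK n N a p (HK0 n N a q)"
proof -
  let ?X = "lattice_simplex {1..n} N"
  let ?r = "\<lambda>x :: nat \<Rightarrow> nat. real N - real (\<Sum>i=1..n. x i)"
  have expand: "innerK n N a (HK0 n N a p) q
      = (\<Sum>j=1..n. \<Sum>x\<in>?X. (?r x * a j + real (x j)) * p (real_point x) * q (real_point x)
           * weightK n N a x)
      - (\<Sum>j=1..n. \<Sum>x\<in>?X. ?r x * a j * p (real_point x + unit_vec j) * q (real_point x)
           * weightK n N a x)
      - (\<Sum>j=1..n. \<Sum>x\<in>?X. real (x j) * p (real_point x - unit_vec j) * q (real_point x)
           * weightK n N a x)" for p q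
    unfolding HK0_def innerK_sum_left sum_subtractf[symmetric] innerK_def
    by (intro sum.cong refl) (simp add: algebra_simps)
  have raise: "(\<Sum>x\<in>?X. ?r x * a j * p (real_point x + unit_vec j) * q (real_point x) * weightK n N a x)
      = (\<Sum>x\<in>?X. real (x j) * p (real_point x) * q (real_point x - unit_vec j) * weightK n N a x)"
    if "j \<in> {1..n}" for p q j
    using sum_weight_raise[OF that, where N = N and a = a and F = "\<lambda>y. p y * q (y - unit_vec j)"]
    by (simp add: mult.assoc)
  have "(\<Sum>j=1..n. \<Sum>x\<in>?X. ?r x * a j * p (real_point x + unit_vec j) * q (real_point x)
           * weightK n N a x)
      = (\<Sum>j=1..n. \<Sum>x\<in>?X. real (x j) * p (real_point x) * q (real_point x - unit_vec j)
           * weightK n N a x)" for p q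
    by (intro sum.cong refl raise) auto
  from this[of p q] this[of q p] show ?thesis
    unfolding innerK_commute[of n N a p] expand by (simp add: mult_ac)
qed

lemma HKT_self_adjoint: "innerK n N a (HKT n N a p) q = innerK n N a p (HKT n N a q)"
proof -
  have "innerK n N a (HKT n N a p) q = innerK n N a (HK0 n N a p) q + innerK n N a (HK n a 1 p) q"
    for p q by (simp add: HKT_def innerK_add_left)
  from this[of p q] this[of q p] show ?thesis
    using HK0_self_adjoint[of n N a p q] HK_self_adjoint[of 1 n N a p q]
    by (simp add: innerK_commute[of n N a p])
qed

lemma self_adjoint_orthogonal:
  assumes "innerK n N a (H p) q = innerK n N a p (H q)"
    and "H p = (\<lambda>x. c * p x)" and "H q = (\<lambda>x. d * q x)" and "c \<noteq> d"
  shows "innerK n N a p q = 0"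
  using assms by (simp add: innerK_scale_left innerK_commute[of n N a p])

text \<open>
  If two eigenpolynomials are not orthogonal, all their eigenvalues agree.  As the sums of the \<open>a\<^sub>k\<close> are
  positive, all tail sums of \<open>m\<close> and \<open>m'\<close> agree, and their differences are the entries.
\<close>

lemma PK_orthogonal:
  assumes "1 \<le> n" and pos: "\<And>j. j \<in> {1..n} \<Longrightarrow> 0 < a j"
    and m: "m \<in> lattice_simplex {0..<n} N" and m': "m' \<in> lattice_simplex {0..<n} N" and "m \<noteq> m'"
  shows "innerK n N a (PK n N a m) (PK n N a m') = 0"
proof (rule ccontr)
  assume nz: "innerK n N a (PK n N a m) (PK n N a m') \<noteq> 0"
  have tails: "(\<Sum>j=i..n-1. m j) = (\<Sum>j=i..n-1. m' j)" if "i \<le> n" for i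
  proof (cases "i = 0")
    case True
    have ivl: "{0..<n} = {0..n-1}" using assms(1) by auto
    have "HKT n N a (PK n N a m)
        = (\<lambda>x. real (\<Sum>j=0..n-1. m j) * ((\<Sum>i=1..n. a i) + 1) * PK n N a m x)"
      if "m \<in> lattice_simplex {0..<n} N" for m
    proof -
      have "(\<Sum>j=0..n-1. m j) \<le> N" using that unfolding lattice_simplex_def ivl by blast
      then show ?thesis using HKT_PK[of n a, OF assms(1) pos] by blast
    qed
    from self_adjoint_orthogonal[OF HKT_self_adjoint this[OF m] this[OF m']]
    have "real (\<Sum>j=0..n-1. m j) * ((\<Sum>i=1..n. a i) + 1)
        = real (\<Sum>j=0..n-1. m' j) * ((\<Sum>i=1..n. a i) + 1)"
      using nz by blast
    moreover have "(\<Sum>i=1..n. a i) > 0" using assms(1) pos by (intro sum_pos) auto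
    ultimately show ?thesis using True by (simp del: of_nat_sum)
  next
    case False
    then have "1 \<le> i" by simp
    have "HK n a i (PK n N a m)
        = (\<lambda>x. real (\<Sum>j=i..n-1. m j) * (\<Sum>k=i..n. a k) * PK n N a m x)" for m
      using HK_PK[of i n a, OF \<open>1 \<le> i\<close> that pos] by blast
    from self_adjoint_orthogonal[OF HK_self_adjoint[OF \<open>1 \<le> i\<close>] this[of m] this[of m']]
    have "real (\<Sum>j=i..n-1. m j) * (\<Sum>k=i..n. a k) = real (\<Sum>j=i..n-1. m' j) * (\<Sum>k=i..n. a k)"
      using nz by blast
    moreover have "(\<Sum>k=i..n. a k) > 0" using pos that \<open>1 \<le> i\<close> by (intro sum_pos) auto
    ultimately show ?thesis by (simp del: of_nat_sum)
  qed
  have "m i = m' i" for i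
  proof (cases "i < n")
    case True
    then have "(\<Sum>j=i..n-1. f j) = f i + (\<Sum>j=Suc i..n-1. f j)" for f :: "nat \<Rightarrow> nat"
      by (intro sum.atLeast_Suc_atMost) auto
    then show ?thesis using tails[of i] tails[of "Suc i"] True by simp
  next
    case False
    then show ?thesis using m m' by (simp add: lattice_simplex_def)
  qed
  with \<open>m \<noteq> m'\<close> show False by auto
qed

section \<open>Polynomial functions of bounded degree\<close>

lemma polys_add: "p \<in> polys n d \<Longrightarrow> q \<in> polys n d \<Longrightarrow> (\<lambda>x. p x + q x) \<in> polys n d"
  unfolding polys_def using rfun.span_add[of p _ q] by (simp add: plus_fun_def)

lemma polys_scale: "p \<in> polys n d \<Longrightarrow> (\<lambda>x. c * p x) \<in> polys n d"
  unfolding polys_def using rfun.span_scale[of p _ c] by (simp add: fscale_def)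

lemma polys_const: "(\<lambda>x. c) \<in> polys n d"
proof -
  have "(\<lambda>x. \<Prod>i=1..n. x i ^ (\<lambda>_. 0) i) \<in> polys n d"
    unfolding polys_def by (intro rfun.span_base CollectI exI[of _ "\<lambda>_. 0"]) auto
  from polys_scale[OF this, of c] show ?thesis by simp
qed

lemma polys_uminus: "p \<in> polys n d \<Longrightarrow> (\<lambda>x. - p x) \<in> polys n d"
  using polys_scale[of p n d "- 1"] by simp

lemma polys_diff: "p \<in> polys n d \<Longrightarrow> q \<in> polys n d \<Longrightarrow> (\<lambda>x. p x - q x) \<in> polys n d"
  using polys_add[OF _ polys_uminus] by force

lemma polys_sum: "(\<And>s. s \<in> S \<Longrightarrow> p s \<in> polys n d) \<Longrightarrow> (\<lambda>x. \<Sum>s\<in>S. p s x) \<in> polys n d"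
  by (induction S rule: infinite_finite_induct) (auto intro: polys_add polys_const)

lemma polys_coord:
  assumes "i \<in> {1..n}"
  shows "(\<lambda>x. x i) \<in> polys n 1"
  unfolding polys_def
proof (intro rfun.span_base CollectI exI[of _ "\<lambda>j. if j = i then 1 else 0"] conjI)
  have single: "(\<Prod>j=1..n. x j ^ (if j = i then 1 else 0)) = x i" for x :: "nat \<Rightarrow> real"
    using assms by (subst prod.cong[OF refl, of _ _ "\<lambda>j. if j = i then x j else 1"]) auto
  show "(\<lambda>x :: nat \<Rightarrow> real. x i) = (\<lambda>x. \<Prod>j=1..n. x j ^ (if j = i then 1 else 0))"
    by (simp only: single)
  show "(\<Sum>j=1..n. if j = i then 1 else 0) \<le> (1 :: nat)" by simp
qed

lemma polys_mono: "d \<le> e \<Longrightarrow> polys n d \<subseteq> polys n e"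
  unfolding polys_def by (intro rfun.span_mono) auto

lemma polys_mult:
  assumes "p \<in> polys n d" "q \<in> polys n e"
  shows "(\<lambda>x. p x * q x) \<in> polys n (d + e)"
proof -
  have mono: "(\<lambda>x. (\<Prod>i=1..n. x i ^ \<alpha> i) * (\<Prod>i=1..n. x i ^ \<beta> i)) \<in> polys n (d + e)"
    if "(\<Sum>i=1..n. \<alpha> i) \<le> d" "(\<Sum>i=1..n. \<beta> i) \<le> e" for \<alpha> \<beta>
    unfolding polys_def
    by (intro rfun.span_base CollectI exI[of _ "\<lambda>i. \<alpha> i + \<beta> i"])
      (use that in \<open>auto simp: power_add prod.distrib sum.distrib\<close>)
  have right: "(\<lambda>x. (\<Prod>i=1..n. x i ^ \<alpha> i) * q x) \<in> polys n (d + e)"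
    if "(\<Sum>i=1..n. \<alpha> i) \<le> d" for \<alpha>
    using assms(2)[unfolded polys_def]
  proof (induction rule: rfun.span_induct_alt)
    case base
    show ?case using polys_const[of 0] by simp
  next
    case (step c b q)
    then obtain \<beta> where \<beta>: "b = (\<lambda>x. \<Prod>i=1..n. x i ^ \<beta> i)" "(\<Sum>i=1..n. \<beta> i) \<le> e" by auto
    from polys_add[OF polys_scale[OF mono[OF that \<beta>(2)], of c] step(2)] show ?case
      by (simp add: \<beta>(1) fscale_def algebra_simps)
  qed
  show ?thesis
    using assms(1)[unfolded polys_def]
  proof (induction rule: rfun.span_induct_alt)
    case base
    show ?case using polys_const[of 0] by simp
  next
    case (step c b p)
    then obtain \<alpha> where \<alpha>: "b = (\<lambda>x. \<Prod>i=1..n. x i ^ \<alpha> i)" "(\<Sum>i=1..n. \<alpha> i) \<le> d" by auto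
    from polys_add[OF polys_scale[OF right[OF \<alpha>(2)], of c] step(2)] show ?case
      by (simp add: \<alpha>(1) fscale_def algebra_simps)
  qed
qed

lemma polys_pochhammer:
  assumes "p \<in> polys n 1"
  shows "(\<lambda>x. pochhammer (p x) k) \<in> polys n k"
proof (induction k)
  case (Suc k)
  from polys_mult[OF this polys_add[OF assms polys_const, of "real k"]] show ?case
    by (simp add: pochhammer_Suc)
qed (simp add: polys_const)

lemma polys_prod:
  "finite S \<Longrightarrow> (\<And>s. s \<in> S \<Longrightarrow> p s \<in> polys n (d s)) \<Longrightarrow> (\<lambda>x. \<Prod>s\<in>S. p s x) \<in> polys n (\<Sum>s\<in>S. d s)"
  by (induction S rule: finite_induct) (auto intro: polys_mult polys_const)

lemma polys_type_two:
  assumes "p \<in> polys n 1" "q \<in> polys n 1"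
  shows "(\<lambda>x. type_two m (p x) (q x) \<alpha> \<gamma>) \<in> polys n m"
  unfolding type_two_def
proof (rule polys_sum)
  fix k assume "k \<in> {0..m}"
  then show "(\<lambda>x. (-1) ^ k * real (m choose k) * (\<gamma> / \<alpha>) ^ k * pochhammer (- p x) k
      * pochhammer (- q x) (m - k)) \<in> polys n m"
    using polys_scale[OF polys_mult[OF polys_pochhammer[OF polys_uminus[OF assms(1)], of k]
          polys_pochhammer[OF polys_uminus[OF assms(2)], of "m - k"]],
        of "(-1) ^ k * real (m choose k) * (\<gamma> / \<alpha>) ^ k"]
    by (simp add: mult.assoc)
qed

lemma polys_krawtchouk:
  assumes "p \<in> polys n 1"
  shows "(\<lambda>x. krawtchouk m (p x) r N) \<in> polys n m"
  unfolding krawtchouk_def hyp2F1_term_def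
proof (rule polys_sum)
  fix k assume "k \<in> {0..m}"
  then have "polys n k \<subseteq> polys n m" by (intro polys_mono) auto
  then show "(\<lambda>x. pochhammer (- real m) k * pochhammer (- p x) k / (pochhammer (- N) k * fact k)
      * (1 / r) ^ k) \<in> polys n m"
    using polys_scale[OF polys_pochhammer[OF polys_uminus[OF assms], of k],
        of "pochhammer (- real m) k / (pochhammer (- N) k * fact k) * (1 / r) ^ k"]
    by (auto simp: mult_ac)
qed

lemma PK_in_polys:
  assumes "1 \<le> n" "m \<in> lattice_simplex {0..<n} N"
  shows "PK n N a m \<in> polys n N"
proof -
  have tail: "(\<lambda>x. (\<Sum>j=l..n. x j) - c) \<in> polys n 1" if "1 \<le> l" for l c
    using that by (intro polys_diff polys_sum polys_const polys_coord) auto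
  have "(\<lambda>x. chain n a m 1 x) \<in> polys n (\<Sum>l=1..n-1. m l)"
    unfolding chain_def chain_factor_def
    by (intro polys_prod polys_type_two tail polys_coord) auto
  then have "PK n N a m \<in> polys n ((\<Sum>l=1..n-1. m l) + m 0)"
    unfolding PK_eq_chain[abs_def] by (intro polys_mult polys_krawtchouk tail) auto
  moreover have "(\<Sum>l=1..n-1. m l) + m 0 \<le> N"
  proof -
    have "{0..<n} = {0..n-1}" using assms(1) by auto
    then show ?thesis
      using assms(2) by (simp add: lattice_simplex_def sum.atLeast_Suc_atMost)
  qed
  ultimately show ?thesis using polys_mono by blast
qed

section \<open>Completeness\<close>

text \<open>
  At the lattice point \<open>M\<^sub>1 e\<^sub>n\<close> every factor is explicit: with \<open>x\<^sub>i = 0\<close> only the term \<open>k = 0\<close> of a type two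
  polynomial survives, and its second argument \<open>M\<^sub>1 - M\<^bsub>i+1\<^esub>\<close> is at least \<open>m\<^sub>i\<close>, so the Pochhammer symbol does not vanish; the
  Krawtchouk polynomial is evaluated at \<open>0\<close>.
\<close>

lemma PK_nonzero:
  assumes "1 \<le> n"
  shows "PK n N a m (\<lambda>i. if i = n then (\<Sum>j=1..n-1. real (m j)) else 0) \<noteq> 0"
proof -
  define M where "M = (\<Sum>j=1..n-1. real (m j))"
  define x where "x = (\<lambda>i. if i = n then M else 0)"
  have tail: "(\<Sum>j=l..n. x j) = M" if "l \<le> n" for l
    using that by (simp add: x_def)
  have "chain_factor n a m l x \<noteq> 0" if l: "l \<in> {1..n-1}" for l
  proof -
    define v where "v = M - (\<Sum>j=l+1..n-1. real (m j))"
    have "{l..n-1} \<subseteq> {1..n-1}" using l by auto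
    then have "(\<Sum>j=l..n-1. real (m j)) \<le> M"
      unfolding M_def by (intro sum_mono2) auto
    then have "v \<ge> real (m l)"
      using l unfolding v_def by (simp add: sum.atLeast_Suc_atMost)
    then have "pochhammer (- v) (m l) \<noteq> 0"
      by (auto simp: pochhammer_eq_0_iff)
    moreover have "type_two (m l) 0 v (a l) g = pochhammer (- v) (m l)" for g
      unfolding type_two_def by (subst sum.remove[of _ 0]) (auto simp: pochhammer_0_left)
    moreover have "chain_factor n a m l x = type_two (m l) 0 v (a l) (\<Sum>j=l+1..n. a j)"
      using l tail[of "l + 1"] unfolding chain_factor_def v_def by (auto simp: x_def)
    ultimately show ?thesis by simp
  qed
  then have "chain n a m 1 x \<noteq> 0" by (simp add: chain_def)
  moreover have "krawtchouk k 0 r N' = 1" for k r N'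
    unfolding krawtchouk_def hyp2F1_term_def by (subst sum.remove[of _ 0]) (auto simp: pochhammer_0_left)
  ultimately have "PK n N a m x \<noteq> 0"
    using assms tail[of 1] by (simp add: PK_eq_chain M_def)
  then show ?thesis unfolding x_def M_def .
qed

lemma PK_norm_pos:
  assumes "1 \<le> n" and pos: "\<And>j. j \<in> {1..n} \<Longrightarrow> 0 < a j"
    and m: "m \<in> lattice_simplex {0..<n} N"
  shows "innerK n N a (PK n N a m) (PK n N a m) > 0"
proof -
  define z where "z = (\<lambda>i. if i = n then (\<Sum>j=1..n-1. m j) else 0)"
  have "(\<Sum>j=1..n-1. m j) \<le> (\<Sum>j\<in>{0..<n}. m j)"
    by (intro sum_mono2) auto
  then have z: "z \<in> lattice_simplex {1..n} N"
    using m assms(1) by (auto simp: lattice_simplex_def z_def)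
  have "real_point z = (\<lambda>i. if i = n then (\<Sum>j=1..n-1. real (m j)) else 0)"
    by (auto simp: z_def)
  then have "PK n N a m (real_point z) \<noteq> 0"
    using PK_nonzero[OF assms(1), of N a m] by simp
  then have "0 < PK n N a m (real_point z) * PK n N a m (real_point z) * weightK n N a z"
    using weightK_pos[of n a N z] pos by (auto simp: zero_less_mult_iff neq_iff)
  moreover have "0 \<le> PK n N a m (real_point y) * PK n N a m (real_point y) * weightK n N a y" for y
    by (intro mult_nonneg_nonneg[OF zero_le_square] less_imp_le[OF weightK_pos] pos)
  ultimately show ?thesis
    unfolding innerK_def by (intro sum_pos2[OF finite_lattice_simplex z]) auto
qed

lemma orthogonal_family_independent:
  assumes "finite I" and norm: "\<And>m. m \<in> I \<Longrightarrow> innerK n N a (b m) (b m) \<noteq> 0"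
    and orth: "\<And>m m'. m \<in> I \<Longrightarrow> m' \<in> I \<Longrightarrow> m \<noteq> m' \<Longrightarrow> innerK n N a (b m) (b m') = 0"
  shows "inj_on b I" and "\<not> rfun.dependent (b ` I)"
proof -
  show "inj_on b I"
  proof (rule inj_onI, rule ccontr)
    fix m m' assume "m \<in> I" "m' \<in> I" "b m = b m'" "m \<noteq> m'"
    with norm[of m] orth[of m m'] show False by simp
  qed
  have sum_apply: "(\<Sum>s\<in>S. F s) x = (\<Sum>s\<in>S. F s x)"
    for S :: "((nat \<Rightarrow> real) \<Rightarrow> real) set" and F :: "_ \<Rightarrow> (nat \<Rightarrow> real) \<Rightarrow> real" and x
    by (induction S rule: infinite_finite_induct) auto
  show "\<not> rfun.dependent (b ` I)"
  proof
    assume "rfun.dependent (b ` I)"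
    then obtain u w where w: "w \<in> b ` I" "u w \<noteq> 0"
      and zero: "(\<Sum>v\<in>b ` I. fscale (u v) v) = 0"
      unfolding rfun.dependent_finite[OF finite_imageI[OF assms(1)]] by blast
    have "(\<Sum>v\<in>b ` I. u v * v x) = 0" for x
      using fun_cong[OF zero, of x] by (simp add: sum_apply fscale_def)
    then have "innerK n N a (\<lambda>x. \<Sum>v\<in>b ` I. u v * v x) w = 0"
      by (simp add: innerK_def)
    then have "(\<Sum>v\<in>b ` I. u v * innerK n N a v w) = 0"
      by (simp only: innerK_sum_left innerK_scale_left)
    also have "(\<Sum>v\<in>b ` I. u v * innerK n N a v w) = u w * innerK n N a w w"
      using assms(1) w(1) by (subst sum.remove[of _ w]) (auto intro!: sum.neutral orth)
    finally show False using w norm by auto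
  qed
qed

text \<open>
  Moving the labels \<open>1, \<dots>, n\<close> of the exponents to \<open>0, \<dots>, n-1\<close> compares the monomials with the degrees
  \<open>m\<close> of the eigenpolynomials.
\<close>

lemma polys_span_finite:
  assumes "1 \<le> n"
  obtains T where "finite T" "card T \<le> card (lattice_simplex {0..<n} d)" "polys n d = rfun.span T"
proof
  let ?T = "{(\<lambda>x :: nat \<Rightarrow> real. \<Prod>i=1..n. x i ^ \<alpha> i) | \<alpha> :: nat \<Rightarrow> nat. (\<Sum>i=1..n. \<alpha> i) \<le> d}"
  let ?f = "\<lambda>\<beta> (x :: nat \<Rightarrow> real). \<Prod>i=1..n. x i ^ \<beta> (i - 1)"
  have sub: "?T \<subseteq> ?f ` lattice_simplex {0..<n} d"
  proof clarify
    fix \<alpha> :: "nat \<Rightarrow> nat" assume le: "(\<Sum>i=1..n. \<alpha> i) \<le> d"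
    let ?\<beta> = "\<lambda>j. if j < n then \<alpha> (Suc j) else 0"
    have "(\<Sum>j\<in>{0..<n}. ?\<beta> j) = (\<Sum>i=1..n. \<alpha> i)"
      by (rule sum.reindex_bij_witness[of _ "\<lambda>i. i - 1" Suc]) auto
    then have "?\<beta> \<in> lattice_simplex {0..<n} d" using le by (auto simp: lattice_simplex_def)
    moreover have "(\<lambda>x :: nat \<Rightarrow> real. \<Prod>i=1..n. x i ^ \<alpha> i) = ?f ?\<beta>"
      by (intro ext prod.cong) auto
    ultimately show "(\<lambda>x :: nat \<Rightarrow> real. \<Prod>i=1..n. x i ^ \<alpha> i) \<in> ?f ` lattice_simplex {0..<n} d"
      by (rule rev_image_eqI[where f = ?f and x = ?\<beta>])
  qed
  show "finite ?T" by (rule finite_subset[OF sub]) (simp add: finite_lattice_simplex)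
  show "card ?T \<le> card (lattice_simplex {0..<n} d)"
    by (rule surj_card_le[OF _ sub]) (simp add: finite_lattice_simplex)
  show "polys n d = rfun.span ?T" by (simp add: polys_def)
qed

lemma PK_basis:
  assumes "1 \<le> n" and pos: "\<And>j. j \<in> {1..n} \<Longrightarrow> 0 < a j"
  shows "is_basis_family (PK n N a) (lattice_simplex {0..<n} N) (polys n N)"
proof -
  let ?I = "lattice_simplex {0..<n} N"
  let ?B = "PK n N a ` ?I"
  have fin: "finite ?I" by (simp add: finite_lattice_simplex)
  have norm: "innerK n N a (PK n N a m) (PK n N a m) \<noteq> 0" if "m \<in> ?I" for m
    using PK_norm_pos[of n a, OF assms that] by simp
  have orth: "innerK n N a (PK n N a m) (PK n N a m') = 0" if "m \<in> ?I" "m' \<in> ?I" "m \<noteq> m'" for m m'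
    using assms that by (rule PK_orthogonal)
  have inj: "inj_on (PK n N a) ?I" and indep: "\<not> rfun.dependent ?B"
    using orthogonal_family_independent[of ?I n N a "PK n N a", OF fin norm orth] by auto
  obtain T where T: "finite T" "card T \<le> card ?I" "polys n N = rfun.span T"
    using polys_span_finite[OF assms(1)] .
  have sub: "?B \<subseteq> rfun.span T" using PK_in_polys[OF assms(1)] T(3) by blast
  \<comment> \<open>A vector outside the span would enlarge the family to one with more independent members than
    there are monomials.\<close>
  have "t \<in> rfun.span ?B" if t: "t \<in> rfun.span T" for t
  proof (rule ccontr)
    assume out: "t \<notin> rfun.span ?B"
    then have "\<not> rfun.dependent (insert t ?B)"
      using indep by (simp add: rfun.independent_insert)
    then have "card (insert t ?B) \<le> card T"
      using rfun.independent_span_bound[OF T(1)] sub t by blast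
    moreover have "t \<notin> ?B" using out rfun.span_base by blast
    ultimately show False using T(2) fin card_image[OF inj] by simp
  qed
  moreover have "rfun.span ?B \<subseteq> rfun.span T"
    using sub rfun.span_minimal rfun.subspace_span by blast
  ultimately have "rfun.span ?B = polys n N" using T(3) by blast
  then show ?thesis using inj indep by (simp add: is_basis_family_def)
qed

theorem theorem5p1:
  fixes n N :: nat and a :: "nat \<Rightarrow> real"
  assumes "2 \<le> n" and "n < N" and "\<And>i. i \<in> {1..n} \<Longrightarrow> 0 < a i"
  shows
    "is_basis_family (PK n N a) (lattice_simplex {0..<n} N) (polys n N)
     \<and> (\<forall>m\<in>lattice_simplex {0..<n} N.
          (\<forall>x. PK n N a m x =
             (\<Prod>i=1..n-1. \<Sum>k=0..m i.
                (-1) ^ k * real (m i choose k) * ((\<Sum>j=i+1..n. a j) / a i) ^ k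
                * pochhammer (- x i) k
                * pochhammer (- (\<Sum>j=i+1..n. x j) + (\<Sum>j=i+1..n-1. real (m j))) (m i - k))
             * hyp2F1_term (m 0) (- (\<Sum>i=1..n. x i) + (\<Sum>j=1..n-1. real (m j)))
                 (- real N + (\<Sum>j=1..n-1. real (m j)))
                 (((\<Sum>i=1..n. a i) + 1) / (\<Sum>i=1..n. a i)))
          \<and> HKT n N a (PK n N a m) =
              (\<lambda>x. real (\<Sum>j=0..n-1. m j) * ((\<Sum>i=1..n. a i) + 1) * PK n N a m x)
          \<and> (\<forall>i\<in>{1..n-1}. HK n a i (PK n N a m) =
              (\<lambda>x. real (\<Sum>j=i..n-1. m j) * (\<Sum>j=i..n. a j) * PK n N a m x)))
     \<and> (\<forall>m\<in>lattice_simplex {0..<n} N. \<forall>m'\<in>lattice_simplex {0..<n} N.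
          m \<noteq> m' \<longrightarrow> innerK n N a (PK n N a m) (PK n N a m') = 0)"
proof (intro conjI ballI impI)
  note pos = assms(3)
  have "1 \<le> n" using assms(1) by simp
  show "is_basis_family (PK n N a) (lattice_simplex {0..<n} N) (polys n N)"
    using \<open>1 \<le> n\<close> pos by (rule PK_basis)
  fix m assume m: "m \<in> lattice_simplex {0..<n} N"
  show "\<forall>x. PK n N a m x =
      (\<Prod>i=1..n-1. \<Sum>k=0..m i.
         (-1) ^ k * real (m i choose k) * ((\<Sum>j=i+1..n. a j) / a i) ^ k
         * pochhammer (- x i) k
         * pochhammer (- (\<Sum>j=i+1..n. x j) + (\<Sum>j=i+1..n-1. real (m j))) (m i - k))
      * hyp2F1_term (m 0) (- (\<Sum>i=1..n. x i) + (\<Sum>j=1..n-1. real (m j)))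
          (- real N + (\<Sum>j=1..n-1. real (m j)))
          (((\<Sum>i=1..n. a i) + 1) / (\<Sum>i=1..n. a i))"
  proof -
    have "- (p - q) = - p + q" "1 / (p / q) = q / p" for p q :: real by simp_all
    then show ?thesis by (simp only: PK_def type_two_def krawtchouk_def simp_thms)
  qed
  have "{0..<n} = {0..n-1}" using \<open>1 \<le> n\<close> by auto
  then have "(\<Sum>j=0..n-1. m j) \<le> N" using m by (simp add: lattice_simplex_def)
  then show "HKT n N a (PK n N a m) =
      (\<lambda>x. real (\<Sum>j=0..n-1. m j) * ((\<Sum>i=1..n. a i) + 1) * PK n N a m x)"
    using HKT_PK[of n a, OF \<open>1 \<le> n\<close> pos] by blast
  show "HK n a i (PK n N a m) = (\<lambda>x. real (\<Sum>j=i..n-1. m j) * (\<Sum>j=i..n. a j) * PK n N a m x)"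
    if "i \<in> {1..n-1}" for i
    using that pos by (intro ext HK_PK) auto
  show "innerK n N a (PK n N a m) (PK n N a m') = 0"
    if "m' \<in> lattice_simplex {0..<n} N" "m \<noteq> m'" for m'
    using \<open>1 \<le> n\<close> pos m that by (rule PK_orthogonal)
qed

end
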